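(* Let $\mathbf{x}:U\to\mathbb{R}^3$ be a proper frontal with extendable normal curvature. Then, locally (on a neighborhood of each point of $U$) and after a rigid motion of $\mathbb{R}^3$, $\mathbf{x}$ has a tangent moving basis of the form $$\mathbf{\Omega}=\begin{pmatrix} 1 & 0 \\ 0 & 1 \\ g_1 & g_2 \end{pmatrix},\qquad \mathbf{\Lambda}_\Omega^T=D(a,b),$$ satisfying $$D(g_1,g_2)=\begin{pmatrix} h_1 & h_2 \\ h_2 & h_3 \end{pmatrix}D(a,b),$$ where $a,b,g_1,g_2,h_1,h_2,h_3$ are smooth real-valued functions.
   Context: All maps are $C^\infty$ and $U\subset\mathbb{R}^2$ is open. $D$ denotes the Jacobian matrix of a map. A tangent moving basis (tmb) of $\mathbf{x}:U\to\mathbb{R}^3$ is a smooth map $\mathbf{\Omega}=(\mathbf{w}_1\ \mathbf{w}_2):U\to\mathcal{M}_{3\times2}(\mathbb{R})$ with columns linearly independent at every point and $\mathbf{x}_u,\mathbf{x}_v\in\mathrm{span}(\mathbf{w}_1,\mathbf{w}_2)$. The map $\mathbf{x}$ is a frontal if near each point there is a smooth unit vector field orthogonal to $\mathbf{x}_u,\mathbf{x}_v$; equivalently, tmbs exist locally, and frontals are always assumed to have a global tmb. The normal field induced by $\mathbf{\Omega}$ is $\mathbf{n}=\frac{\mathbf{w}_1\times\mathbf{w}_2}{\|\mathbf{w}_1\times\mathbf{w}_2\|}$. $\Sigma(\mathbf{x})$ is the set of points where $\mathbf{x}$ is not immersive; the frontal is proper if $\Sigma(\mathbf{x})$ has empty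 interior. Set $\mathbf{I}=D\mathbf{x}^TD\mathbf{x}$, $\mathbf{II}=-D\mathbf{x}^TD\mathbf{n}$ and $\mathbf{\Lambda}_\Omega=D\mathbf{x}^T\mathbf{\Omega}(\mathbf{\Omega}^T\mathbf{\Omega})^{-1}$, so that $D\mathbf{x}=\mathbf{\Omega}\mathbf{\Lambda}_\Omega^T$. Normal curvature: at $p\in\Sigma(\mathbf{x})^c$, $k_p(\zeta)=\frac{\zeta^T\mathbf{II}\zeta}{\zeta^T\mathbf{I}\zeta}$ for $\zeta\in\mathbb{R}^2-\{0\}$. It is extendable if $(p,\omega)\mapsto k_p(\mathbf{\Lambda}_\Omega^{-T}\omega)$ on $\Sigma(\mathbf{x})^c\times(\mathbb{R}^2-\{0\})$ has a smooth extension to $U\times(\mathbb{R}^2-\{0\})$, where $\mathbf{\Omega}$ is a tmb of $\mathbf{x}$. *)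

theory Defs
  imports "HOL-Analysis.Analysis"
begin

text \<open>The functions below are total, but only their values on an open set \<open>U\<close> are meant; the two
  smoothness predicates are used for open \<open>U\<close> only. Over a finite-dimensional domain, continuity
  of all directional derivatives of order up to \<open>k\<close> is the usual notion of class \<open>C\<^sup>k\<close>.\<close>

fun Ck_on :: "nat \<Rightarrow> 'a set \<Rightarrow> ('a::euclidean_space \<Rightarrow> 'b::real_normed_vector) \<Rightarrow> bool" where
  "Ck_on 0 U f \<longleftrightarrow> continuous_on U f"
| "Ck_on (Suc k) U f \<longleftrightarrow> (\<forall>x\<in>U. f differentiable at x) \<and>
     (\<forall>v. Ck_on k U (\<lambda>x. frechet_derivative f (at x) v))"

definition smooth_on :: "'a set \<Rightarrow> ('a::euclidean_space \<Rightarrow> 'b::real_normed_vector) \<Rightarrow> bool" where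
  "smooth_on U f \<longleftrightarrow> (\<forall>k. Ck_on k U f)"

text \<open>The Jacobian matrix; its columns 1 and 2 are the partial derivatives \<open>f\<^sub>u\<close> and \<open>f\<^sub>v\<close>.\<close>

abbreviation Jac :: "(real^2 \<Rightarrow> real^'m) \<Rightarrow> real^2 \<Rightarrow> real^2^'m" where
  "Jac f p \<equiv> jacobian f (at p)"

definition tangent_moving_basis ::
  "(real^2) set \<Rightarrow> (real^2 \<Rightarrow> real^3) \<Rightarrow> (real^2 \<Rightarrow> real^2^3) \<Rightarrow> bool" where
  "tangent_moving_basis U x \<Omega> \<longleftrightarrow> smooth_on U \<Omega> \<and>
     (\<forall>p\<in>U. let w1 = column 1 (\<Omega> p); w2 = column 2 (\<Omega> p) in
        w1 \<noteq> w2 \<and> independent {w1, w2} \<and>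
        column 1 (Jac x p) \<in> span {w1, w2} \<and> column 2 (Jac x p) \<in> span {w1, w2})"

text \<open>The last conjunct is the standing assumption that a frontal comes with a global tangent
  moving basis.\<close>

definition frontal :: "(real^2) set \<Rightarrow> (real^2 \<Rightarrow> real^3) \<Rightarrow> bool" where
  "frontal U x \<longleftrightarrow> smooth_on U x \<and>
     (\<forall>p\<in>U. \<exists>V n. open V \<and> p \<in> V \<and> V \<subseteq> U \<and> smooth_on V n \<and>
        (\<forall>q\<in>V. norm (n q) = 1 \<and> n q \<bullet> column 1 (Jac x q) = 0 \<and> n q \<bullet> column 2 (Jac x q) = 0)) \<and>
     (\<exists>\<Omega>. tangent_moving_basis U x \<Omega>)"

definition singular_set :: "(real^2) set \<Rightarrow> (real^2 \<Rightarrow> real^3) \<Rightarrow> (real^2) set" where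
  "singular_set U x = {p \<in> U. \<not> inj (frechet_derivative x (at p))}"

definition proper_frontal :: "(real^2) set \<Rightarrow> (real^2 \<Rightarrow> real^3) \<Rightarrow> bool" where
  "proper_frontal U x \<longleftrightarrow> frontal U x \<and> interior (singular_set U x) = {}"

definition normal_field :: "(real^2 \<Rightarrow> real^2^3) \<Rightarrow> real^2 \<Rightarrow> real^3" where
  "normal_field \<Omega> p = (let w = cross3 (column 1 (\<Omega> p)) (column 2 (\<Omega> p)) in w /\<^sub>R norm w)"

definition first_form :: "(real^2 \<Rightarrow> real^3) \<Rightarrow> real^2 \<Rightarrow> real^2^2" where
  "first_form x p = transpose (Jac x p) ** Jac x p"

definition second_form :: "(real^2 \<Rightarrow> real^3) \<Rightarrow> (real^2 \<Rightarrow> real^2^3) \<Rightarrow> real^2 \<Rightarrow> real^2^2" where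
  "second_form x \<Omega> p = - (transpose (Jac x p) ** Jac (normal_field \<Omega>) p)"

definition Lambda :: "(real^2 \<Rightarrow> real^3) \<Rightarrow> (real^2 \<Rightarrow> real^2^3) \<Rightarrow> real^2 \<Rightarrow> real^2^2" where
  "Lambda x \<Omega> p = transpose (Jac x p) ** \<Omega> p ** matrix_inv (transpose (\<Omega> p) ** \<Omega> p)"

definition normal_curvature ::
  "(real^2 \<Rightarrow> real^3) \<Rightarrow> (real^2 \<Rightarrow> real^2^3) \<Rightarrow> real^2 \<Rightarrow> real^2 \<Rightarrow> real" where
  "normal_curvature x \<Omega> p \<zeta> =
     (\<zeta> \<bullet> (second_form x \<Omega> p *v \<zeta>)) / (\<zeta> \<bullet> (first_form x p *v \<zeta>))"

text \<open>Extendability does not depend on the tangent moving basis: for another basis \<open>\<Omega> B\<close>, the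
  function to be extended is composed with \<open>(p, \<omega>) \<mapsto> (p, B(p) \<omega>)\<close> and multiplied by the
  sign of \<open>det B\<close>. So it is enough to ask for one basis.\<close>

definition extendable_normal_curvature :: "(real^2) set \<Rightarrow> (real^2 \<Rightarrow> real^3) \<Rightarrow> bool" where
  "extendable_normal_curvature U x \<longleftrightarrow>
     (\<exists>\<Omega> K. tangent_moving_basis U x \<Omega> \<and>
        smooth_on (U \<times> (UNIV - {0})) (K :: (real^2) \<times> (real^2) \<Rightarrow> real) \<and>
        (\<forall>p \<in> U - singular_set U x. \<forall>\<omega>. \<omega> \<noteq> 0 \<longrightarrow>
           K (p, \<omega>) = normal_curvature x \<Omega> p (matrix_inv (transpose (Lambda x \<Omega> p)) *v \<omega>)))"

definition rigid_motion :: "(real^3 \<Rightarrow> real^3) \<Rightarrow> bool" where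
  "rigid_motion T \<longleftrightarrow> (\<exists>R c. rotation_matrix R \<and> T = (\<lambda>y. R *v y + c))"

definition graph_basis ::
  "(real^2 \<Rightarrow> real) \<Rightarrow> (real^2 \<Rightarrow> real) \<Rightarrow> real^2 \<Rightarrow> real^2^3" where
  "graph_basis g1 g2 p = vector [vector [1, 0], vector [0, 1], vector [g1 p, g2 p]]"

definition pair_map :: "(real^2 \<Rightarrow> real) \<Rightarrow> (real^2 \<Rightarrow> real) \<Rightarrow> real^2 \<Rightarrow> real^2" where
  "pair_map a b p = vector [a p, b p]"

end

theory Submission
  imports Defs
begin

text \<open>Rotate space so that the normal of the moving basis at the given point becomes the third
  coordinate direction. Nearby, the rotated basis \<open>W = R \<Omega>\<close> has an invertible upper block, and
  multiplying \<open>W\<close> by the inverse \<open>C\<close> of that block gives the graph basis \<open>G\<close>, whose slopes \<open>g\<^sub>1, g\<^sub>2\<close>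
  are read off the normal direction \<open>M = M\<^sub>3 (-g\<^sub>1, -g\<^sub>2, 1)\<close>. With \<open>y = R x\<close>, the maps \<open>a, b\<close> are the
  first two coordinates of \<open>y\<close>. The relation \<open>M \<bullet> Dy = 0\<close> says \<open>dy\<^sub>3 = g\<^sub>1 da + g\<^sub>2 db\<close>, that is
  \<open>Dy = G D(a,b)\<close>, and as \<open>\<Lambda>\<^sup>T\<close> is the only matrix with this property (\<open>Lambda_eq\<close>), the claim on
  \<open>\<Lambda>\<close> follows.

  At a regular point \<open>D(a,b)\<close> is invertible, so \<open>D(g\<^sub>1,g\<^sub>2) = H D(a,b)\<close> for a unique \<open>H\<close>, and two things
  have to be seen: \<open>H\<close> is symmetric, and it extends smoothly over the singular set. Symmetry is
  \<open>d(dy\<^sub>3) = 0\<close>, i.e. the symmetry of second derivatives of \<open>y\<^sub>3\<close>, \<open>a\<close> and \<open>b\<close>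
  (\<open>contact_form_symmetric\<close>). For the extension, differentiating \<open>M = M\<^sub>3 (-g\<^sub>1, -g\<^sub>2, 1)\<close> shows that
  the second fundamental form of \<open>\<zeta>\<close> is, up to the factor \<open>M\<^sub>3 / |M|\<close>, the inner product
  \<open>D(a,b)\<zeta> \<bullet> D(g\<^sub>1,g\<^sub>2)\<zeta>\<close> (\<open>graph_second_form\<close>). Hence the extension \<open>K\<close> of the normal curvature
  yields, at regular points, the quadratic form of \<open>H\<close>,
  \<open>w \<bullet> H w = (|M| / M\<^sub>3) K(q, C w) |G w|\<^sup>2\<close>,
  whose right-hand side is smooth in \<open>q\<close> near the given point, whether regular or not. Three values
  of a quadratic form determine a symmetric matrix (\<open>symmetric_matrix_from_quadratic_form\<close>), which
  gives smooth \<open>h\<^sub>1, h\<^sub>2, h\<^sub>3\<close>. The identity \<open>D(g\<^sub>1,g\<^sub>2) = H D(a,b)\<close> then holds at regular points, and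
  by continuity everywhere, because the singular set has empty interior.\<close>

section \<open>Calculus of smooth maps\<close>

abbreviation Der :: "('a::euclidean_space \<Rightarrow> 'b::real_normed_vector) \<Rightarrow> 'a \<Rightarrow> 'a \<Rightarrow> 'b" where
  "Der f p \<equiv> frechet_derivative f (at p)"

lemma has_derivative_imp_Der: "(f has_derivative f') (at x) \<Longrightarrow> Der f x = f'"
  using frechet_derivative_at by metis

lemma differentiable_imp_Der: "f differentiable at x \<Longrightarrow> (f has_derivative Der f x) (at x)"
  by (simp add: frechet_derivative_works)

lemma Ck_on_cong:
  assumes "open U" "\<And>x. x \<in> U \<Longrightarrow> f x = g x" "Ck_on k U f"
  shows "Ck_on k U g"
  using assms(2,3)
proof (induction k arbitrary: f g)
  case 0
  then show ?case by (simp cong: continuous_on_cong)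
next
  case (Suc k)
  have der: "(g has_derivative Der f x) (at x)" if "x \<in> U" for x
    using Suc.prems that assms(1)
    by (auto intro: has_derivative_transform_within_open[OF differentiable_imp_Der])
  have "Ck_on k U (\<lambda>x. Der g x v)" for v
  proof (rule Suc.IH)
    show "Ck_on k U (\<lambda>x. Der f x v)" using Suc.prems by simp
    show "Der f x v = Der g x v" if "x \<in> U" for x
      using has_derivative_imp_Der[OF der[OF that]] by simp
  qed
  then show ?case using der by (auto simp: differentiable_def)
qed

lemma Ck_on_SucI:
  assumes "open U" "\<And>x. x \<in> U \<Longrightarrow> (f has_derivative f' x) (at x)"
    and "\<And>v. Ck_on k U (\<lambda>x. f' x v)"
  shows "Ck_on (Suc k) U f"
proof -
  have "Ck_on k U (\<lambda>x. Der f x v)" for v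
    by (rule Ck_on_cong[OF assms(1) _ assms(3)[of v]])
      (simp add: has_derivative_imp_Der[OF assms(2)])
  then show ?thesis using assms(2) by (auto simp: differentiable_def)
qed

lemma Ck_on_Suc_has_derivative:
  "Ck_on (Suc k) U f \<Longrightarrow> x \<in> U \<Longrightarrow> (f has_derivative Der f x) (at x)"
  by (simp add: differentiable_imp_Der)

lemma Ck_on_subset: "Ck_on k U f \<Longrightarrow> V \<subseteq> U \<Longrightarrow> Ck_on k V f"
  by (induction k arbitrary: f) (auto intro: continuous_on_subset)

lemma Ck_on_SucD: "Ck_on (Suc k) U f \<Longrightarrow> Ck_on k U f"
proof (induction k arbitrary: f)
  case 0
  then show ?case
    using differentiable_at_imp_differentiable_on[of U f] differentiable_imp_continuous_on by auto
next
  case (Suc k)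
  then show ?case by (metis Ck_on.simps(2))
qed

lemma Ck_on_linear:
  assumes "open U" "bounded_linear L" "Ck_on k U f"
  shows "Ck_on k U (\<lambda>x. L (f x))"
  using assms(3)
proof (induction k arbitrary: f)
  case 0
  then show ?case using bounded_linear.continuous_on[OF assms(2)] by simp
next
  case (Suc k)
  show ?case
  proof (rule Ck_on_SucI[OF assms(1)])
    show "((\<lambda>x. L (f x)) has_derivative (\<lambda>v. L (Der f x v))) (at x)" if "x \<in> U" for x
      by (rule bounded_linear.has_derivative[OF assms(2) Ck_on_Suc_has_derivative[OF Suc.prems that]])
    show "Ck_on k U (\<lambda>x. L (Der f x v))" for v
      using Suc by simp
  qed
qed

lemma Ck_on_const: "open U \<Longrightarrow> Ck_on k U (\<lambda>x. c)"
proof (induction k arbitrary: c)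
  case (Suc k)
  show ?case by (rule Ck_on_SucI[OF Suc.prems, where f' = "\<lambda>_ _. 0"]) (use Suc in auto)
qed simp

lemma Ck_on_add:
  assumes "open U" "Ck_on k U f" "Ck_on k U g"
  shows "Ck_on k U (\<lambda>x. f x + g x)"
  using assms(2,3)
proof (induction k arbitrary: f g)
  case 0
  then show ?case by (simp add: continuous_on_add)
next
  case (Suc k)
  show ?case
  proof (rule Ck_on_SucI[OF assms(1), where f' = "\<lambda>x v. Der f x v + Der g x v"])
    show "((\<lambda>x. f x + g x) has_derivative (\<lambda>v. Der f x v + Der g x v)) (at x)"
      if "x \<in> U" for x
      by (intro has_derivative_add Ck_on_Suc_has_derivative[OF Suc.prems(1) that]
          Ck_on_Suc_has_derivative[OF Suc.prems(2) that])
    show "Ck_on k U (\<lambda>x. Der f x v + Der g x v)" for v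
      using Suc by simp
  qed
qed

lemma Ck_on_scaleR:
  assumes "open U" "Ck_on k U f" "Ck_on k U g"
  shows "Ck_on k U (\<lambda>x. f x *\<^sub>R g x)"
  using assms(2,3)
proof (induction k arbitrary: f g)
  case 0
  then show ?case by (simp add: continuous_on_scaleR)
next
  case (Suc k)
  show ?case
  proof (rule Ck_on_SucI[OF assms(1), where f' = "\<lambda>x v. f x *\<^sub>R Der g x v + Der f x v *\<^sub>R g x"])
    show "((\<lambda>x. f x *\<^sub>R g x) has_derivative (\<lambda>v. f x *\<^sub>R Der g x v + Der f x v *\<^sub>R g x)) (at x)"
      if "x \<in> U" for x
      by (intro has_derivative_scaleR Ck_on_Suc_has_derivative[OF Suc.prems(1) that]
          Ck_on_Suc_has_derivative[OF Suc.prems(2) that])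
    show "Ck_on k U (\<lambda>x. f x *\<^sub>R Der g x v + Der f x v *\<^sub>R g x)" for v
      using Suc.prems Ck_on_SucD[OF Suc.prems(1)] Ck_on_SucD[OF Suc.prems(2)]
      by (intro Ck_on_add assms(1) Suc.IH) simp_all
  qed
qed

lemma Ck_on_sum:
  "open U \<Longrightarrow> (\<And>i. i \<in> I \<Longrightarrow> Ck_on k U (f i)) \<Longrightarrow> Ck_on k U (\<lambda>x. \<Sum>i\<in>I. f i x)"
  by (induction I rule: infinite_finite_induct) (auto intro: Ck_on_const Ck_on_add)

text \<open>Expanding \<open>Dg v\<close> in a basis turns the chain rule into a finite sum of products of a component
  of \<open>Dg v\<close> with a derivative of \<open>f\<close> in a constant direction, composed with \<open>g\<close>. The latter is why
  the induction is over all \<open>f\<close> at once.\<close>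
lemma Ck_on_compose:
  fixes f :: "'b::euclidean_space \<Rightarrow> 'c::real_normed_vector" and g :: "'a::euclidean_space \<Rightarrow> 'b"
  assumes "open U" "\<And>x. x \<in> U \<Longrightarrow> g x \<in> W" "Ck_on k W f" "Ck_on k U g"
  shows "Ck_on k U (\<lambda>x. f (g x))"
  using assms(3,4)
proof (induction k arbitrary: f)
  case 0
  then show ?case
    using assms(2) by (auto intro: continuous_on_compose2)
next
  case (Suc k)
  show ?case
  proof (rule Ck_on_SucI[OF assms(1), where f' = "\<lambda>x v. \<Sum>b\<in>Basis. (Der g x v \<bullet> b) *\<^sub>R Der f (g x) b"])
    fix x assume x: "x \<in> U"
    have f: "(f has_derivative Der f (g x)) (at (g x))"
      by (rule Ck_on_Suc_has_derivative[OF Suc.prems(1) assms(2)[OF x]])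
    have "((\<lambda>x. f (g x)) has_derivative (\<lambda>v. Der f (g x) (Der g x v))) (at x)"
      by (rule has_derivative_compose[OF Ck_on_Suc_has_derivative[OF Suc.prems(2) x] f])
    moreover have "Der f (g x) (Der g x v) = (\<Sum>b\<in>Basis. (Der g x v \<bullet> b) *\<^sub>R Der f (g x) b)" for v
    proof -
      have "Der f (g x) (Der g x v) = Der f (g x) (\<Sum>b\<in>Basis. (Der g x v \<bullet> b) *\<^sub>R b)"
        by (simp add: euclidean_representation)
      then show ?thesis
        using has_derivative_linear[OF f] by (simp add: linear_sum linear_scale)
    qed
    ultimately show "((\<lambda>x. f (g x)) has_derivative
        (\<lambda>v. \<Sum>b\<in>Basis. (Der g x v \<bullet> b) *\<^sub>R Der f (g x) b)) (at x)"
      by simp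
  next
    fix v
    show "Ck_on k U (\<lambda>x. \<Sum>b\<in>Basis. (Der g x v \<bullet> b) *\<^sub>R Der f (g x) b)"
    proof (intro Ck_on_sum Ck_on_scaleR assms(1))
      fix b :: 'b
      show "Ck_on k U (\<lambda>x. Der g x v \<bullet> b)"
        using Ck_on_linear[OF assms(1) bounded_linear_inner_left, of k "\<lambda>x. Der g x v" b] Suc.prems(2)
        by simp
      show "Ck_on k U (\<lambda>x. Der f (g x) b)"
        using Suc.prems(1) by (intro Suc.IH Ck_on_SucD[OF Suc.prems(2)]) simp
    qed
  qed
qed

text \<open>The derivative of the reciprocal is a polynomial in the reciprocal itself, so each order of
  differentiability gives the next one.\<close>
lemma Ck_on_inverse: "Ck_on k (UNIV - {0}) (inverse :: real \<Rightarrow> real)"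
proof (induction k)
  case 0
  then show ?case by (auto intro!: continuous_intros)
next
  case (Suc k)
  show ?case
  proof (rule Ck_on_SucI[where f' = "\<lambda>x v. inverse x *\<^sub>R (inverse x *\<^sub>R (- v))"])
    show "(inverse has_derivative (\<lambda>v. inverse x *\<^sub>R (inverse x *\<^sub>R (- v)))) (at x)"
      if "x \<in> UNIV - {0}" for x :: real
      by (rule has_derivative_eq_rhs[OF has_derivative_inverse']) (use that in auto)
    show "Ck_on k (UNIV - {0}) (\<lambda>x::real. inverse x *\<^sub>R (inverse x *\<^sub>R (- v)))" for v
      by (intro Ck_on_scaleR Ck_on_const Suc.IH) auto
  qed auto
qed

text \<open>The same bootstrapping works for the root, once its derivative is written as
  \<open>sqrt x * inverse x / 2\<close>.\<close>
lemma Ck_on_sqrt: "Ck_on k {0<..} sqrt"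
proof (induction k)
  case 0
  then show ?case by (auto intro!: continuous_intros)
next
  case (Suc k)
  show ?case
  proof (rule Ck_on_SucI[where f' = "\<lambda>x v. sqrt x *\<^sub>R (inverse x *\<^sub>R (v / 2))"])
    show "(sqrt has_derivative (\<lambda>v. sqrt x *\<^sub>R (inverse x *\<^sub>R (v / 2)))) (at x)"
      if "x \<in> {0<..}" for x :: real
    proof -
      have "sqrt x * inverse x = inverse (sqrt x)"
        using that by (simp add: field_simps)
      then have e: "inverse (sqrt x) / 2 * v = sqrt x *\<^sub>R (inverse x *\<^sub>R (v / 2))" for v
        by (metis (no_types, lifting) mult.assoc real_scaleR_def times_divide_eq_left times_divide_eq_right)
      have "(sqrt has_real_derivative inverse (sqrt x) / 2) (at x)"
        using that by (intro DERIV_real_sqrt) auto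
      then show ?thesis unfolding has_field_derivative_def e .
    qed
    show "Ck_on k {0<..} (\<lambda>x::real. sqrt x *\<^sub>R (inverse x *\<^sub>R (v / 2)))" for v :: real
      by (intro Ck_on_scaleR Ck_on_const Suc.IH Ck_on_subset[OF Ck_on_inverse]) auto
  qed auto
qed

lemma smooth_on_subset: "smooth_on U f \<Longrightarrow> V \<subseteq> U \<Longrightarrow> smooth_on V f"
  unfolding smooth_on_def by (blast intro: Ck_on_subset)

lemma smooth_on_const: "open U \<Longrightarrow> smooth_on U (\<lambda>x. c)"
  by (simp add: smooth_on_def Ck_on_const)

lemma smooth_on_linear:
  "open U \<Longrightarrow> smooth_on U f \<Longrightarrow> bounded_linear L \<Longrightarrow> smooth_on U (\<lambda>x. L (f x))"
  by (simp add: smooth_on_def Ck_on_linear[where L = L and f = f])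

lemma smooth_on_add:
  "open U \<Longrightarrow> smooth_on U f \<Longrightarrow> smooth_on U g \<Longrightarrow> smooth_on U (\<lambda>x. f x + g x)"
  by (simp add: smooth_on_def Ck_on_add)

lemma smooth_on_scaleR:
  "open U \<Longrightarrow> smooth_on U f \<Longrightarrow> smooth_on U g \<Longrightarrow> smooth_on U (\<lambda>x. f x *\<^sub>R g x)"
  by (simp add: smooth_on_def Ck_on_scaleR)

lemma smooth_on_mult:
  fixes f g :: "'a::euclidean_space \<Rightarrow> real"
  shows "open U \<Longrightarrow> smooth_on U f \<Longrightarrow> smooth_on U g \<Longrightarrow> smooth_on U (\<lambda>x. f x * g x)"
  using smooth_on_scaleR[of U f g] by simp

lemma smooth_on_minus:
  "open U \<Longrightarrow> smooth_on U f \<Longrightarrow> smooth_on U (\<lambda>x. - f x)"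
  by (rule smooth_on_linear[OF _ _ bounded_linear_minus[OF bounded_linear_ident]])

lemma smooth_on_diff:
  assumes "open U" "smooth_on U f" "smooth_on U g"
  shows "smooth_on U (\<lambda>x. f x - g x)"
  using smooth_on_add[OF assms(1,2) smooth_on_minus[OF assms(1,3)]] by simp

lemma smooth_on_compose:
  fixes f :: "'b::euclidean_space \<Rightarrow> 'c::real_normed_vector" and g :: "'a::euclidean_space \<Rightarrow> 'b"
  shows "open U \<Longrightarrow> smooth_on W f \<Longrightarrow> smooth_on U g \<Longrightarrow> (\<And>x. x \<in> U \<Longrightarrow> g x \<in> W) \<Longrightarrow>
    smooth_on U (\<lambda>x. f (g x))"
  by (simp add: smooth_on_def Ck_on_compose[where f = f and g = g and W = W])

lemma smooth_on_divide:
  fixes f g :: "'a::euclidean_space \<Rightarrow> real"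
  assumes "open U" "smooth_on U f" "smooth_on U g" "\<And>x. x \<in> U \<Longrightarrow> g x \<noteq> 0"
  shows "smooth_on U (\<lambda>x. f x / g x)"
proof -
  have "smooth_on (UNIV - {0}) (inverse :: real \<Rightarrow> real)"
    by (simp add: smooth_on_def Ck_on_inverse)
  from smooth_on_compose[OF assms(1) this assms(3)] assms(4)
  have "smooth_on U (\<lambda>x. inverse (g x))" by simp
  from smooth_on_mult[OF assms(1,2) this] show ?thesis by (simp add: divide_inverse)
qed

lemma smooth_on_sqrt:
  "open U \<Longrightarrow> smooth_on U f \<Longrightarrow> (\<And>x. x \<in> U \<Longrightarrow> f x > 0) \<Longrightarrow> smooth_on U (\<lambda>x. sqrt (f x))"
  by (rule smooth_on_compose[where W = "{0<..}"]) (auto simp: smooth_on_def Ck_on_sqrt)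

lemma smooth_on_Pair:
  fixes f :: "'a::euclidean_space \<Rightarrow> 'b::real_normed_vector" and g :: "'a \<Rightarrow> 'c::real_normed_vector"
  assumes "open U" "smooth_on U f" "smooth_on U g"
  shows "smooth_on U (\<lambda>x. (f x, g x))"
proof -
  have 1: "bounded_linear (\<lambda>u::'b. (u, 0::'c))"
    by (intro bounded_linear_Pair bounded_linear_ident bounded_linear_zero)
  have 2: "bounded_linear (\<lambda>u::'c. (0::'b, u))"
    by (intro bounded_linear_Pair bounded_linear_ident bounded_linear_zero)
  from smooth_on_add[OF assms(1) smooth_on_linear[OF assms(1,2) 1] smooth_on_linear[OF assms(1,3) 2]]
  show ?thesis by simp
qed

lemma smooth_on_ident: "open U \<Longrightarrow> smooth_on U (\<lambda>x. x)"
  unfolding smooth_on_def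
proof
  fix k
  assume "open U"
  then show "Ck_on k U (\<lambda>x. x)"
  proof (cases k)
    case (Suc j)
    show ?thesis unfolding Suc
      by (rule Ck_on_SucI[OF \<open>open U\<close>, where f' = "\<lambda>_ v. v"]) (auto intro: Ck_on_const \<open>open U\<close>)
  qed (simp add: continuous_on_id)
qed

lemma smooth_on_has_derivative: "smooth_on U f \<Longrightarrow> x \<in> U \<Longrightarrow> (f has_derivative Der f x) (at x)"
  unfolding smooth_on_def using Ck_on_Suc_has_derivative by blast

lemma smooth_on_Der: "smooth_on U f \<Longrightarrow> smooth_on U (\<lambda>x. Der f x v)"
  unfolding smooth_on_def by (metis Ck_on.simps(2))

lemma smooth_on_imp_continuous_on: "smooth_on U f \<Longrightarrow> continuous_on U f"
  unfolding smooth_on_def by (metis Ck_on.simps(1))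

section \<open>Symmetry of second derivatives\<close>

text \<open>The mean value theorem is used first along \<open>u\<close>, on the difference of \<open>f\<close> between two parallel
  sides, and then along \<open>v\<close>, on the derivative of \<open>f\<close> in direction \<open>u\<close>.\<close>
lemma second_difference_mean_value:
  fixes f :: "'a::euclidean_space \<Rightarrow> real"
  assumes h: "0 < h"
    and sub: "\<And>s t. 0 \<le> s \<Longrightarrow> s \<le> h \<Longrightarrow> 0 \<le> t \<Longrightarrow> t \<le> h \<Longrightarrow> p + s *\<^sub>R u + t *\<^sub>R v \<in> V"
    and f: "smooth_on V f"
  shows "\<exists>s t. 0 < s \<and> s < h \<and> 0 < t \<and> t < h \<and>
    f (p + h *\<^sub>R u + h *\<^sub>R v) - f (p + h *\<^sub>R u) - f (p + h *\<^sub>R v) + f p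
      = h * (h * Der (\<lambda>y. Der f y u) (p + s *\<^sub>R u + t *\<^sub>R v) v)"
proof -
  have du: "((\<lambda>s. F (p + s *\<^sub>R u + t *\<^sub>R v)) has_real_derivative Der F (p + s *\<^sub>R u + t *\<^sub>R v) u) (at s)"
    if "0 \<le> s" "s \<le> h" "0 \<le> t" "t \<le> h" "smooth_on V F" for s t and F :: "'a \<Rightarrow> real"
  proof -
    note D = smooth_on_has_derivative[OF that(5) sub[OF that(1-4)]]
    have "((\<lambda>s. p + s *\<^sub>R u + t *\<^sub>R v) has_derivative (\<lambda>r. r *\<^sub>R u)) (at s)"
      by (auto intro!: derivative_eq_intros)
    from has_derivative_compose[OF this D] show ?thesis
      unfolding has_field_derivative_def using linear_scale[OF has_derivative_linear[OF D]]
      by (simp add: mult.commute[of _ "Der F _ u"])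
  qed
  have dv: "((\<lambda>t. F (p + s *\<^sub>R u + t *\<^sub>R v)) has_real_derivative Der F (p + s *\<^sub>R u + t *\<^sub>R v) v) (at t)"
    if "0 \<le> s" "s \<le> h" "0 \<le> t" "t \<le> h" "smooth_on V F" for s t and F :: "'a \<Rightarrow> real"
  proof -
    note D = smooth_on_has_derivative[OF that(5) sub[OF that(1-4)]]
    have "((\<lambda>t. p + s *\<^sub>R u + t *\<^sub>R v) has_derivative (\<lambda>r. r *\<^sub>R v)) (at t)"
      by (auto intro!: derivative_eq_intros)
    from has_derivative_compose[OF this D] show ?thesis
      unfolding has_field_derivative_def using linear_scale[OF has_derivative_linear[OF D]]
      by (simp add: mult.commute[of _ "Der F _ v"])
  qed
  have "\<exists>s. 0 < s \<and> s < h \<and>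
      (\<lambda>s. f (p + s *\<^sub>R u + h *\<^sub>R v) - f (p + s *\<^sub>R u + 0 *\<^sub>R v)) h
      - (\<lambda>s. f (p + s *\<^sub>R u + h *\<^sub>R v) - f (p + s *\<^sub>R u + 0 *\<^sub>R v)) 0
      = (h - 0) * (Der f (p + s *\<^sub>R u + h *\<^sub>R v) u - Der f (p + s *\<^sub>R u + 0 *\<^sub>R v) u)"
    by (rule MVT2[OF h]) (intro DERIV_diff du f; use h in simp)
  then obtain s where s: "0 < s" "s < h" and
    eq1: "f (p + h *\<^sub>R u + h *\<^sub>R v) - f (p + h *\<^sub>R u) - f (p + h *\<^sub>R v) + f p
      = h * (Der f (p + s *\<^sub>R u + h *\<^sub>R v) u - Der f (p + s *\<^sub>R u) u)"
    by (auto simp: algebra_simps)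
  have "\<exists>t. 0 < t \<and> t < h \<and>
      (\<lambda>t. Der f (p + s *\<^sub>R u + t *\<^sub>R v) u) h - (\<lambda>t. Der f (p + s *\<^sub>R u + t *\<^sub>R v) u) 0
      = (h - 0) * Der (\<lambda>y. Der f y u) (p + s *\<^sub>R u + t *\<^sub>R v) v"
    by (rule MVT2[OF h]) (use s in \<open>auto intro!: dv smooth_on_Der f\<close>)
  then obtain t where "0 < t" "t < h" and
    "Der f (p + s *\<^sub>R u + h *\<^sub>R v) u - Der f (p + s *\<^sub>R u) u
      = h * Der (\<lambda>y. Der f y u) (p + s *\<^sub>R u + t *\<^sub>R v) v"
    by auto
  with s eq1 show ?thesis by metis
qed

text \<open>The second difference of \<open>f\<close> over a small parallelogram is symmetric in its two sides, and it
  can be evaluated by either of the two iterated derivatives, at points close to \<open>p\<close>. If these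
  derivatives differed at \<open>p\<close>, their continuity would keep them apart on a small parallelogram.\<close>
lemma Der_Der_commute:
  fixes f :: "'a::euclidean_space \<Rightarrow> real"
  assumes "open V" "p \<in> V" and f: "smooth_on V f"
  shows "Der (\<lambda>y. Der f y u) p v = Der (\<lambda>y. Der f y v) p u"
proof (rule ccontr)
  assume ne: "Der (\<lambda>y. Der f y u) p v \<noteq> Der (\<lambda>y. Der f y v) p u" (is "?A p \<noteq> ?B p")
  define e where "e = \<bar>?A p - ?B p\<bar> / 2"
  have e: "0 < e" using ne by (simp add: e_def)
  have "continuous_on V ?A" "continuous_on V ?B"
    by (intro smooth_on_imp_continuous_on smooth_on_Der f)+
  then have "isCont ?A p" "isCont ?B p"
    using assms by (simp_all add: continuous_on_eq_continuous_at)
  then have "\<exists>d>0. \<forall>y. dist y p < d \<longrightarrow> dist (?A y) (?A p) < e"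
    "\<exists>d>0. \<forall>y. dist y p < d \<longrightarrow> dist (?B y) (?B p) < e"
    using e by (simp_all only: continuous_at_eps_delta)
  then obtain d1 d2 where d1: "0 < d1" "\<And>y. dist y p < d1 \<Longrightarrow> dist (?A y) (?A p) < e"
    and d2: "0 < d2" "\<And>y. dist y p < d2 \<Longrightarrow> dist (?B y) (?B p) < e"
    by auto
  obtain d3 where d3: "0 < d3" "ball p d3 \<subseteq> V" using assms open_contains_ball by blast
  define d where "d = min d1 (min d2 d3)"
  \<comment> \<open>Small enough for the parallelogram with sides \<open>h u\<close> and \<open>h v\<close> to lie within distance \<open>d\<close> of \<open>p\<close>.\<close>
  define h where "h = d / (2 * (norm u + norm v + 1))"
  have d: "0 < d" using d1 d2 d3 by (simp add: d_def)
  have pos: "0 < norm u + norm v + 1" by (simp add: add_nonneg_pos)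
  have h: "0 < h" using d pos by (simp add: h_def)
  have near: "dist (p + s *\<^sub>R u + t *\<^sub>R v) p < d" if "0 \<le> s" "s \<le> h" "0 \<le> t" "t \<le> h" for s t
  proof -
    have "dist (p + s *\<^sub>R u + t *\<^sub>R v) p \<le> s * norm u + t * norm v"
      using norm_triangle_ineq[of "s *\<^sub>R u" "t *\<^sub>R v"] that by (simp add: dist_norm add.assoc)
    also have "\<dots> \<le> h * norm u + h * norm v"
      by (intro add_mono mult_right_mono that norm_ge_zero)
    also have "\<dots> < h * (2 * (norm u + norm v + 1))"
      using h pos by (simp add: algebra_simps add_nonneg_pos add_pos_nonneg)
    also have "\<dots> = d" using pos by (simp add: h_def)
    finally show ?thesis .
  qed
  have sub: "p + s *\<^sub>R u + t *\<^sub>R v \<in> V" if "0 \<le> s" "s \<le> h" "0 \<le> t" "t \<le> h" for s t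
    using near[OF that] d3(2) by (auto simp: d_def dist_commute)
  have sub': "p + s *\<^sub>R v + t *\<^sub>R u \<in> V" if "0 \<le> s" "s \<le> h" "0 \<le> t" "t \<le> h" for s t
    using sub[of t s] that by (simp add: add_ac)
  obtain s t where st: "0 < s" "s < h" "0 < t" "t < h" and
    1: "f (p + h *\<^sub>R u + h *\<^sub>R v) - f (p + h *\<^sub>R u) - f (p + h *\<^sub>R v) + f p
      = h * (h * ?A (p + s *\<^sub>R u + t *\<^sub>R v))"
    using second_difference_mean_value[OF h sub f] by blast
  obtain s' t' where st': "0 < s'" "s' < h" "0 < t'" "t' < h" and
    2: "f (p + h *\<^sub>R v + h *\<^sub>R u) - f (p + h *\<^sub>R v) - f (p + h *\<^sub>R u) + f p
      = h * (h * ?B (p + s' *\<^sub>R v + t' *\<^sub>R u))"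
    using second_difference_mean_value[OF h sub' f] by blast
  have "p + h *\<^sub>R v + h *\<^sub>R u = p + h *\<^sub>R u + h *\<^sub>R v"
    and "p + s' *\<^sub>R v + t' *\<^sub>R u = p + t' *\<^sub>R u + s' *\<^sub>R v"
    by (simp_all add: add_ac)
  note 2 = 2[unfolded this]
  have "h * (h * ?A (p + s *\<^sub>R u + t *\<^sub>R v)) = h * (h * ?B (p + t' *\<^sub>R u + s' *\<^sub>R v))"
    using 1 2 by linarith
  then have "?A (p + s *\<^sub>R u + t *\<^sub>R v) = ?B (p + t' *\<^sub>R u + s' *\<^sub>R v)" using h by simp
  moreover have "dist (?A (p + s *\<^sub>R u + t *\<^sub>R v)) (?A p) < e"
    using near[of s t] st by (intro d1) (auto simp: d_def)
  moreover have "dist (?B (p + t' *\<^sub>R u + s' *\<^sub>R v)) (?B p) < e"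
    using near[of t' s'] st' by (intro d2) (auto simp: d_def)
  ultimately have "dist (?A p) (?B p) < e + e"
    by (intro dist_triangle_less_add[where y = "?A (p + s *\<^sub>R u + t *\<^sub>R v)"])
      (simp_all add: dist_commute)
  then show False by (simp add: e_def dist_real_def)
qed

section \<open>Maps with vector and matrix values\<close>

lemma vec_euclidean_decomposition: "(w :: 'b::euclidean_space^'n) = (\<Sum>i\<in>UNIV. axis i (w $ i))"
  by (simp add: vec_eq_iff axis_def)

text \<open>Applied twice, this also settles smoothness of matrix-valued maps entry by entry.\<close>
lemma smooth_on_vec:
  fixes f :: "'a::euclidean_space \<Rightarrow> 'b::euclidean_space^'n"
  assumes "open U" "\<And>i. smooth_on U (\<lambda>q. f q $ i)"
  shows "smooth_on U f"
proof -
  have ax: "bounded_linear (axis i :: 'b \<Rightarrow> 'b^'n)" for i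
    by (simp add: linear_conv_bounded_linear[symmetric] linear_iff vec_eq_iff axis_def)
  have "Ck_on k U (\<lambda>q. \<Sum>i\<in>UNIV. axis i (f q $ i))" for k
    using assms by (intro Ck_on_sum Ck_on_linear[OF _ ax]) (auto simp: smooth_on_def)
  then show ?thesis
    by (simp add: smooth_on_def vec_euclidean_decomposition[symmetric])
qed

lemma smooth_on_vec_nth:
  "open U \<Longrightarrow> smooth_on U f \<Longrightarrow> smooth_on U (\<lambda>q. f q $ i)"
  by (rule smooth_on_linear[where L = "\<lambda>w. w $ i"]) (auto intro: bounded_linear_vec_nth)

lemma Der_vec_nth:
  "f differentiable at p \<Longrightarrow> Der (\<lambda>q. f q $ i) p z = Der f p z $ i"
  using has_derivative_imp_Der[OF bounded_linear.has_derivative[OF bounded_linear_vec_nth differentiable_imp_Der]]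
  by metis

lemma Der_matrix_mult:
  fixes R :: "real^'n^'m"
  shows "f differentiable at p \<Longrightarrow> Der (\<lambda>q. R *v f q) p z = R *v Der f p z"
  using has_derivative_imp_Der[OF bounded_linear.has_derivative[OF matrix_vector_mul_bounded_linear differentiable_imp_Der]]
  by metis

lemma linear_Der: "f differentiable at p \<Longrightarrow> linear (Der f p)"
  using differentiable_imp_Der has_derivative_linear by blast

lemma Jac_mult_vec: "f differentiable at p \<Longrightarrow> Jac f p *v z = Der f p z"
  using has_derivative_imp_Der[of f "\<lambda>z. Jac f p *v z" p] jacobian_works[of f "at p"] by simp

lemma smooth_on_imp_differentiable: "smooth_on U f \<Longrightarrow> p \<in> U \<Longrightarrow> f differentiable at p"
  using smooth_on_has_derivative differentiableI by blast

lemma pair_map_has_derivative: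
  assumes "a differentiable at p" "b differentiable at p"
  shows "(pair_map a b has_derivative (\<lambda>z. vector [Der a p z, Der b p z])) (at p)"
proof -
  have v: "vector [s, t] = s *\<^sub>R (axis 1 1 :: real^2) + t *\<^sub>R axis 2 1" for s t
    by (simp add: vec_eq_iff forall_2 axis_def)
  show ?thesis
    unfolding pair_map_def[abs_def] v
    by (intro has_derivative_add has_derivative_scaleR_left differentiable_imp_Der assms)
qed

lemma Jac_pair_map:
  assumes "a differentiable at p" "b differentiable at p"
  shows "Jac (pair_map a b) p *v z = vector [Der a p z, Der b p z]"
  using Jac_mult_vec[OF differentiableI[OF pair_map_has_derivative[OF assms]]]
    has_derivative_imp_Der[OF pair_map_has_derivative[OF assms]] by simp

lemma inner_transpose_mult: "z \<bullet> (transpose A *v w) = (A *v z) \<bullet> w" for A :: "real^'n^'m"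
  by (metis dot_lmul_matrix inner_commute transpose_matrix_vector)

section \<open>Moving bases and the normal direction\<close>

lemma normal_curvature_eq:
  assumes "x differentiable at p" "normal_field \<Omega> differentiable at p"
  shows "normal_curvature x \<Omega> p z =
    - (Der x p z \<bullet> Der (normal_field \<Omega>) p z) / (Der x p z \<bullet> Der x p z)"
proof -
  have m: "- A *v z = - (A *v z)" for A :: "real^2^2"
    by (simp add: vec_eq_iff matrix_vector_mult_def sum_negf)
  show ?thesis
    unfolding normal_curvature_def second_form_def first_form_def m
    by (simp add: matrix_vector_mul_assoc[symmetric] inner_transpose_mult Jac_mult_vec assms
        del: transpose_matrix_vector)
qed

lemma matrix_inv_mult:
  assumes "invertible A"
  shows "A ** matrix_inv A = mat 1" "matrix_inv A ** A = mat 1"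
  using someI_ex[OF assms[unfolded invertible_def]] by (simp_all add: matrix_inv_def)

lemma invertible_ker: "(\<And>z. A *v z = 0 \<Longrightarrow> z = 0) \<Longrightarrow> invertible A" for A :: "real^'n^'n"
  using matrix_left_invertible_ker[of A] invertible_left_inverse[of A] by blast

text \<open>\<open>(\<Omega>\<^sup>T \<Omega>)\<^sup>-\<^sup>1 \<Omega>\<^sup>T\<close> is a left inverse of \<open>\<Omega>\<close>, so \<open>\<Lambda>\<^sup>T\<close> recovers any \<open>M\<close> that factors the
  Jacobian through \<open>\<Omega>\<close>. This is how both \<open>\<Lambda>\<close> of the given basis and \<open>\<Lambda>\<close> of the graph basis are
  computed.\<close>
lemma Lambda_eq:
  assumes inj: "\<And>z. \<Omega> p *v z = 0 \<Longrightarrow> z = 0" and J: "Jac x p = \<Omega> p ** M"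
  shows "Lambda x \<Omega> p = transpose M"
proof -
  define P where "P = transpose (\<Omega> p) ** \<Omega> p"
  have "invertible P"
  proof (rule invertible_ker)
    fix z assume "P *v z = 0"
    then have "z \<bullet> (transpose (\<Omega> p) *v (\<Omega> p *v z)) = 0"
      by (simp add: P_def matrix_vector_mul_assoc)
    then show "z = 0" using inj by (simp add: inner_transpose_mult del: transpose_matrix_vector)
  qed
  from matrix_inv_mult(1)[OF this] show ?thesis
    unfolding Lambda_def J P_def matrix_transpose_mul
    by (metis matrix_mul_assoc matrix_mul_rid)
qed

lemma matrix_mult_2_columns: "A *v z = z $ 1 *\<^sub>R column 1 A + z $ 2 *\<^sub>R column 2 A" for A :: "real^2^'m"
  by (simp add: vec_eq_iff matrix_vector_mult_def sum_2 column_def mult.commute)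

text \<open>Cramer's rule: the cross product with a column extracts a coordinate of \<open>z\<close>.\<close>
lemma cross3_columns_mult:
  fixes A :: "real^2^3"
  shows "cross3 (column 1 A) (A *v z) = z $ 2 *\<^sub>R cross3 (column 1 A) (column 2 A)"
    and "cross3 (A *v z) (column 2 A) = z $ 1 *\<^sub>R cross3 (column 1 A) (column 2 A)"
  unfolding matrix_mult_2_columns
  by (simp_all add: cross_add_left cross_add_right cross_mult_left cross_mult_right)

lemma tangent_moving_basis_cross3_nonzero:
  assumes "tangent_moving_basis U x \<Omega>" "p \<in> U"
  shows "cross3 (column 1 (\<Omega> p)) (column 2 (\<Omega> p)) \<noteq> 0"
proof
  let ?w1 = "column 1 (\<Omega> p)" and ?w2 = "column 2 (\<Omega> p)"
  have ind: "?w1 \<noteq> ?w2" "independent {?w1, ?w2}"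
    using assms by (auto simp: tangent_moving_basis_def Let_def)
  assume "cross3 ?w1 ?w2 = 0"
  then have "collinear {0, ?w1, ?w2}" by (simp add: cross_eq_0)
  then have "?w1 = 0 \<or> ?w2 = 0 \<or> (\<exists>c. ?w2 = c *\<^sub>R ?w1)" by (simp add: collinear_lemma)
  moreover have "?w1 \<noteq> 0" "?w2 \<noteq> 0" using ind(2) dependent_zero[of "{?w1, ?w2}"] by auto
  moreover have "?w2 \<notin> span {?w1}"
    using ind independent_insert[of ?w2 "{?w1}"] insert_commute[of ?w1 ?w2 "{}"] by auto
  ultimately show False by (metis span_base span_scale singletonI)
qed

text \<open>The tangency of the basis enters the proof in this form, because orthogonality to the cross
  product is preserved by rotations and can be read in coordinates.\<close>
lemma tangent_moving_basis_cross3_orthogonal: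
  assumes "tangent_moving_basis U x \<Omega>" "p \<in> U" "x differentiable at p"
  shows "cross3 (column 1 (\<Omega> p)) (column 2 (\<Omega> p)) \<bullet> Der x p z = 0"
proof -
  let ?w1 = "column 1 (\<Omega> p)" and ?w2 = "column 2 (\<Omega> p)"
  have "span {?w1, ?w2} \<subseteq> {v. cross3 ?w1 ?w2 \<bullet> v = 0}"
    by (rule span_minimal) (auto simp: dot_cross_self subspace_hyperplane)
  moreover have "column 1 (Jac x p) \<in> span {?w1, ?w2}" "column 2 (Jac x p) \<in> span {?w1, ?w2}"
    using assms by (auto simp: tangent_moving_basis_def Let_def)
  then have "Jac x p *v z \<in> span {?w1, ?w2}"
    by (simp add: matrix_mult_2_columns span_add span_scale)
  ultimately show ?thesis by (auto simp: Jac_mult_vec assms)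
qed

lemma cross3_nonzero_imp_kernel_trivial:
  fixes A :: "real^2^3"
  assumes "cross3 (column 1 A) (column 2 A) \<noteq> 0" "A *v z = 0"
  shows "z = 0"
proof -
  have "z $ 2 = 0" "z $ 1 = 0"
    using cross3_columns_mult[of A z] assms by auto
  then show ?thesis by (simp add: vec_eq_iff forall_2)
qed

lemma exists_rotation_to_third_axis: "\<exists>R. rotation_matrix R \<and> R *v (v :: real^3) = norm v *\<^sub>R axis 3 1"
proof -
  obtain f where f: "orthogonal_transformation f" "det (matrix f) = 1" "f v = norm v *\<^sub>R axis 3 1"
    by (rule rotation_exists[of v "norm v *\<^sub>R axis 3 1"]) auto
  have "rotation_matrix (matrix f)"
    using f by (simp add: rotation_matrix_def orthogonal_transformation_matrix)
  moreover have "matrix f *v v = f v"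
    using orthogonal_transformation_linear[OF f(1)] by (simp add: matrix_vector_mul)
  ultimately show ?thesis using f(3) by metis
qed

lemma rotation_inner:
  fixes R :: "real^'n^'n"
  shows "rotation_matrix R \<Longrightarrow> (R *v v) \<bullet> (R *v w) = v \<bullet> w"
  using inner_transpose_mult[of v R "R *v w"]
  by (simp add: matrix_vector_mul_assoc rotation_matrix_def orthogonal_matrix
      del: transpose_matrix_vector)

section \<open>Passing to a graph basis\<close>

lemma graph_basis_mult:
  "graph_basis g1 g2 q *v w = vector [w $ 1, w $ 2, g1 q * w $ 1 + g2 q * w $ 2]"
  by (simp add: graph_basis_def vec_eq_iff forall_3 matrix_vector_mult_def sum_2)

text \<open>The inverse of the upper square block of \<open>W\<close>, whose determinant \<open>d\<close> is the third component of
  the cross product of the columns.\<close>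
definition top_inverse :: "real^2^3 \<Rightarrow> real^2^2" where
  "top_inverse W = (let d = cross3 (column 1 W) (column 2 W) $ 3 in
     vector [vector [W $ 2 $ 2 / d, - W $ 1 $ 2 / d], vector [- W $ 2 $ 1 / d, W $ 1 $ 1 / d]])"

text \<open>Changing a basis of a plane multiplies the cross product of its columns by a scalar. The graph
  basis has cross product \<open>(-g\<^sub>1, -g\<^sub>2, 1)\<close>, so the slopes are quotients of components of \<open>M\<close>.\<close>
lemma mult_top_inverse:
  fixes W :: "real^2^3"
  defines "M \<equiv> cross3 (column 1 W) (column 2 W)"
  assumes "M $ 3 \<noteq> 0" "g1 q = - (M $ 1 / M $ 3)" "g2 q = - (M $ 2 / M $ 3)"
  shows "W ** top_inverse W = graph_basis g1 g2 q"
proof -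
  have d: "M $ 3 = W$1$1 * W$2$2 - W$1$2 * W$2$1"
    "M $ 1 = W$2$1 * W$3$2 - W$2$2 * W$3$1" "M $ 2 = W$3$1 * W$1$2 - W$3$2 * W$1$1"
    by (simp_all add: M_def cross3_def column_def)
  show ?thesis
    unfolding top_inverse_def graph_basis_def M_def[symmetric] Let_def
    using assms(2)
    by (simp add: vec_eq_iff forall_2 forall_3 matrix_matrix_mult_def sum_2 assms(3,4))
      (simp add: divide_simps, simp add: d algebra_simps)
qed

section \<open>The second fundamental form of a graph basis\<close>

text \<open>Differentiating the length of \<open>m\<close> contributes only a multiple of \<open>m\<close>, which is orthogonal
  to \<open>w\<close>. Hence second fundamental forms can be computed with an unnormalised normal.\<close>
lemma Der_inner_normalized:
  fixes m :: "'a::euclidean_space \<Rightarrow> 'b::euclidean_space"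
  assumes m: "m differentiable at p" "m p \<noteq> 0" and orth: "m p \<bullet> w = 0"
  shows "(\<lambda>q. m q /\<^sub>R norm (m q)) differentiable at p"
    and "w \<bullet> Der (\<lambda>q. m q /\<^sub>R norm (m q)) p z = (w \<bullet> Der m p z) / norm (m p)"
proof -
  have "(\<lambda>q. inverse (norm (m q))) differentiable at p"
  proof (rule differentiable_inverse)
    show "(\<lambda>q. norm (m q)) differentiable at p"
      using has_derivative_compose[OF differentiable_imp_Der[OF m(1)] has_derivative_norm[OF m(2)]]
      by (auto simp: differentiable_def)
  qed (use m in simp)
  from has_derivative_scaleR[OF differentiable_imp_Der[OF this] differentiable_imp_Der[OF m(1)]]
  have D: "((\<lambda>q. m q /\<^sub>R norm (m q)) has_derivative
    (\<lambda>z. Der m p z /\<^sub>R norm (m p) + Der (\<lambda>q. inverse (norm (m q))) p z *\<^sub>R m p)) (at p)" .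
  then show "(\<lambda>q. m q /\<^sub>R norm (m q)) differentiable at p" by (auto simp: differentiable_def)
  show "w \<bullet> Der (\<lambda>q. m q /\<^sub>R norm (m q)) p z = (w \<bullet> Der m p z) / norm (m p)"
    unfolding has_derivative_imp_Der[OF D] using orth
    by (simp add: inner_add_right inner_commute[of w "m p"] divide_inverse mult.commute)
qed

text \<open>Differentiating \<open>M = M\<^sub>3 (-g\<^sub>1, -g\<^sub>2, 1)\<close> gives a term along \<open>(-g\<^sub>1, -g\<^sub>2, 1)\<close>, to which the tangent
  vector \<open>w\<close> is orthogonal, and a term containing the derivatives of the slopes.\<close>
lemma graph_second_form:
  fixes M :: "real^2 \<Rightarrow> real^3"
  assumes "open V" "q \<in> V" "g1 differentiable at q" "g2 differentiable at q" "M differentiable at q"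
    and M1: "\<And>r. r \<in> V \<Longrightarrow> M r $ 1 = - (g1 r * M r $ 3)"
    and M2: "\<And>r. r \<in> V \<Longrightarrow> M r $ 2 = - (g2 r * M r $ 3)"
    and w: "w $ 3 = g1 q * w $ 1 + g2 q * w $ 2"
  shows "w \<bullet> Der M q z = - (M q $ 3 * (w $ 1 * Der g1 q z + w $ 2 * Der g2 q z))"
proof -
  have nth: "((\<lambda>r. M r $ i) has_derivative (\<lambda>z. Der M q z $ i)) (at q)" for i
    by (rule bounded_linear.has_derivative[OF bounded_linear_vec_nth differentiable_imp_Der]) fact
  have *: "Der M q z $ i = - (g q * Der M q z $ 3 + Der g q z * M q $ 3)"
    if "g differentiable at q" and eq: "\<And>r. r \<in> V \<Longrightarrow> M r $ i = - (g r * M r $ 3)" for g i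
  proof -
    have D: "((\<lambda>r. - (g r * M r $ 3)) has_derivative
        (\<lambda>z. - (g q * Der M q z $ 3 + Der g q z * M q $ 3))) (at q)"
      by (intro has_derivative_minus has_derivative_mult nth differentiable_imp_Der that(1))
    have "((\<lambda>r. M r $ i) has_derivative
        (\<lambda>z. - (g q * Der M q z $ 3 + Der g q z * M q $ 3))) (at q)"
      by (rule has_derivative_transform_within_open[OF D assms(1,2)]) (simp add: eq)
    from has_derivative_unique[OF nth this] show ?thesis by meson
  qed
  show ?thesis
    by (simp add: inner_vec_def sum_3 *[OF assms(3) M1] *[OF assms(4) M2] w algebra_simps)
qed

text \<open>This is \<open>0 = d(dc) = dg\<^sub>1 \<and> da + dg\<^sub>2 \<and> db\<close>, evaluated on \<open>u\<close> and \<open>v\<close>: differentiating the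
  hypothesis, the second derivatives of \<open>a\<close>, \<open>b\<close> and \<open>c\<close> cancel by symmetry. It will make the
  matrix \<open>H\<close> symmetric.\<close>
lemma contact_form_symmetric:
  fixes a b c g1 g2 :: "'a::euclidean_space \<Rightarrow> real"
  assumes V: "open V" "q \<in> V"
    and s: "smooth_on V a" "smooth_on V b" "smooth_on V c" "smooth_on V g1" "smooth_on V g2"
    and c: "\<And>r z. r \<in> V \<Longrightarrow> Der c r z = g1 r * Der a r z + g2 r * Der b r z"
  shows "Der a q u * Der g1 q v + Der b q u * Der g2 q v
    = Der a q v * Der g1 q u + Der b q v * Der g2 q u"
proof -
  have *: "Der (\<lambda>r. Der c r u) q v =
      g1 q * Der (\<lambda>r. Der a r u) q v + Der g1 q v * Der a q u
      + (g2 q * Der (\<lambda>r. Der b r u) q v + Der g2 q v * Der b q u)" for u v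
  proof -
    have D: "((\<lambda>r. g1 r * Der a r u + g2 r * Der b r u) has_derivative
      (\<lambda>v. g1 q * Der (\<lambda>r. Der a r u) q v + Der g1 q v * Der a q u
      + (g2 q * Der (\<lambda>r. Der b r u) q v + Der g2 q v * Der b q u))) (at q)"
      by (intro has_derivative_add has_derivative_mult smooth_on_has_derivative[OF _ V(2)]
          smooth_on_Der s)
    have "((\<lambda>r. Der c r u) has_derivative
      (\<lambda>v. g1 q * Der (\<lambda>r. Der a r u) q v + Der g1 q v * Der a q u
      + (g2 q * Der (\<lambda>r. Der b r u) q v + Der g2 q v * Der b q u))) (at q)"
      by (rule has_derivative_transform_within_open[OF D V]) (simp add: c)
    from has_derivative_imp_Der[OF this] show ?thesis by simp
  qed
  show ?thesis
    using *[of u v] *[of v u] Der_Der_commute[OF V s(1), of u v]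
      Der_Der_commute[OF V s(2), of u v] Der_Der_commute[OF V s(3), of u v]
    by (simp add: algebra_simps)
qed

section \<open>From the quadratic form to the matrix\<close>

text \<open>Polarisation: \<open>B = H A\<close> for the matrix \<open>H\<close> of \<open>B A\<^sup>-\<^sup>1\<close>, which is symmetric by \<open>sym\<close> and has
  the quadratic form \<open>Q\<close>; its entries are then determined by three values of \<open>Q\<close>. The form is
  evaluated at nonzero vectors only, because the normal curvature is defined only there.\<close>
lemma symmetric_matrix_from_quadratic_form:
  fixes A B :: "real^2 \<Rightarrow> real^2"
  assumes lin: "linear A" "linear B" and inj: "inj A"
    and sym: "\<And>z w. A z \<bullet> B w = A w \<bullet> B z"
    and Q: "\<And>z. z \<noteq> 0 \<Longrightarrow> Q (A z) = A z \<bullet> B z"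
    and h: "h1 = Q (axis 1 1)" "h3 = Q (axis 2 1)"
      "h2 = (Q (axis 1 1 + axis 2 1) - Q (axis 1 1) - Q (axis 2 1)) / 2"
  shows "B z = vector [vector [h1, h2], vector [h2, h3]] *v A z"
proof -
  let ?e1 = "axis 1 1 :: real^2" and ?e2 = "axis 2 1 :: real^2"
  have "surj A" using lin(1) inj by (rule linear_inj_imp_surj)
  then obtain z1 z2 where z: "A z1 = ?e1" "A z2 = ?e2" by (metis surj_def)
  have A0: "A 0 = 0" using lin(1) by (rule linear_0)
  have nzA: "A z1 \<noteq> 0" "A z2 \<noteq> 0" "A (z1 + z2) \<noteq> 0"
    by (simp_all add: linear_add[OF lin(1)] z vec_eq_iff forall_2 axis_def)
  have nz: "z1 \<noteq> 0" "z2 \<noteq> 0" "z1 + z2 \<noteq> 0"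
    using A0 nzA by metis+
  have e: "?e1 \<bullet> v = v $ 1" "?e2 \<bullet> v = v $ 2" for v :: "real^2"
    by (simp_all add: inner_axis')
  have h13: "h1 = B z1 $ 1" "h3 = B z2 $ 2"
    using Q[OF nz(1)] Q[OF nz(2)] by (simp_all add: h z e)
  have s: "B z2 $ 1 = B z1 $ 2" using sym[of z1 z2] by (simp add: z e)
  have "Q (?e1 + ?e2) = (?e1 + ?e2) \<bullet> (B z1 + B z2)"
    using Q[OF nz(3)] by (simp add: linear_add[OF lin(1)] linear_add[OF lin(2)] z)
  then have h2: "h2 = B z1 $ 2"
    using h13 s by (simp add: h inner_add_left e)
  have "A z = A (A z $ 1 *\<^sub>R z1 + A z $ 2 *\<^sub>R z2)"
    by (simp add: linear_add[OF lin(1)] linear_scale[OF lin(1)] z vec_eq_iff forall_2 axis_def)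
  then have "z = A z $ 1 *\<^sub>R z1 + A z $ 2 *\<^sub>R z2" using inj by (simp add: inj_eq)
  then have "B z = A z $ 1 *\<^sub>R B z1 + A z $ 2 *\<^sub>R B z2"
    by (metis linear_add[OF lin(2)] linear_scale[OF lin(2)])
  then show ?thesis
    by (simp add: vec_eq_iff forall_2 matrix_vector_mult_def sum_2 h13 h2 s mult.commute)
qed

lemma continuous_on_eq_zero_off_empty_interior:
  fixes F :: "'a::topological_space \<Rightarrow> 'b::real_normed_vector"
  assumes "open V" "continuous_on V F" "interior S = {}" "\<And>q. q \<in> V - S \<Longrightarrow> F q = 0" "q \<in> V"
  shows "F q = 0"
proof (rule ccontr)
  assume "F q \<noteq> 0"
  have "open (V \<inter> F -` (- {0}))"
    using assms(1,2) by (intro continuous_open_preimage) auto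
  moreover have "V \<inter> F -` (- {0}) \<subseteq> S" using assms(4) by auto
  ultimately have "V \<inter> F -` (- {0}) \<subseteq> interior S" by (rule interior_maximal[rotated])
  then show False using assms(3,5) \<open>F q \<noteq> 0\<close> by auto
qed

section \<open>The graph form of a proper frontal with extendable normal curvature\<close>

theorem proposition3p2:
  fixes U :: "(real^2) set" and x :: "real^2 \<Rightarrow> real^3"
  assumes "open U"
    and "proper_frontal U x"
    and "extendable_normal_curvature U x"
  shows "\<forall>p\<in>U. \<exists>V T. open V \<and> p \<in> V \<and> V \<subseteq> U \<and> rigid_motion T \<and>
    (\<exists>a b g1 g2 h1 h2 h3 :: real^2 \<Rightarrow> real.
       smooth_on V a \<and> smooth_on V b \<and> smooth_on V g1 \<and> smooth_on V g2 \<and>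
       smooth_on V h1 \<and> smooth_on V h2 \<and> smooth_on V h3 \<and>
       tangent_moving_basis V (T \<circ> x) (graph_basis g1 g2) \<and>
       (\<forall>q\<in>V. transpose (Lambda (T \<circ> x) (graph_basis g1 g2) q) = Jac (pair_map a b) q \<and>
          Jac (pair_map g1 g2) q =
            vector [vector [h1 q, h2 q], vector [h2 q, h3 q]] ** Jac (pair_map a b) q))"
proof
  fix p0 assume p0: "p0 \<in> U"
  have xs: "smooth_on U x" and sing: "interior (singular_set U x) = {}"
    using assms(2) by (auto simp: proper_frontal_def frontal_def)
  obtain \<Omega> K where tmb: "tangent_moving_basis U x \<Omega>"
    and Ks: "smooth_on (U \<times> (UNIV - {0})) K"
    and K: "\<And>p w. p \<in> U - singular_set U x \<Longrightarrow> w \<noteq> 0 \<Longrightarrow>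
      K (p, w) = normal_curvature x \<Omega> p (matrix_inv (transpose (Lambda x \<Omega> p)) *v w)"
    using assms(3) unfolding extendable_normal_curvature_def by blast
  have \<Omega>s: "smooth_on U \<Omega>" using tmb by (simp add: tangent_moving_basis_def)
  define m where "m p = cross3 (column 1 (\<Omega> p)) (column 2 (\<Omega> p))" for p
  have m0: "m p \<noteq> 0" if "p \<in> U" for p
    using tangent_moving_basis_cross3_nonzero[OF tmb that] by (simp add: m_def)
  \<comment> \<open>The normal direction at \<open>p0\<close> is rotated to the positive third axis, so that \<open>M $ 3\<close> is positive
    near \<open>p0\<close>; the sign makes the two induced normals agree.\<close>
  obtain R where R: "rotation_matrix R" "R *v m p0 = norm (m p0) *\<^sub>R axis 3 1"
    using exists_rotation_to_third_axis by blast
  define W where "W p = R ** \<Omega> p" for p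
  define M where "M p = R *v m p" for p
  define y where "y p = R *v x p" for p
  have M_cross: "M p = cross3 (column 1 (W p)) (column 2 (W p))" for p
    unfolding M_def m_def W_def matrix_vector_mult_basis[symmetric] matrix_vector_mul_assoc[symmetric]
    using cross_rotation_matrix[OF R(1)] by metis
  have \<Omega>ij: "smooth_on U (\<lambda>p. \<Omega> p $ i $ j)" for i j
    by (intro smooth_on_vec_nth assms(1) \<Omega>s)
  have ms: "smooth_on U m"
  proof (rule smooth_on_vec[OF assms(1)])
    have "\<forall>i. smooth_on U (\<lambda>p. m p $ i)"
      by (simp add: forall_3 m_def cross3_def column_def \<Omega>ij smooth_on_diff smooth_on_mult assms(1))
    then show "smooth_on U (\<lambda>p. m p $ i)" for i by blast
  qed
  have Ms: "smooth_on U M" and ys: "smooth_on U y"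
    unfolding M_def[abs_def] y_def[abs_def]
    by (intro smooth_on_linear[OF assms(1) _ matrix_vector_mul_bounded_linear] ms xs)+
  have Ws: "smooth_on U W"
    unfolding W_def[abs_def]
    by (rule smooth_on_linear[OF assms(1) \<Omega>s])
      (simp add: linear_conv_bounded_linear[symmetric] linear_iff matrix_add_ldistrib
        vec_eq_iff matrix_matrix_mult_def sum_distrib_left sum.distrib algebra_simps)

  \<comment> \<open>The condition \<open>M $ 3 > 0\<close> says that the upper block of \<open>W\<close> has positive determinant.\<close>
  define V where "V = U \<inter> (\<lambda>p. M p $ 3) -` {0<..}"
  have V: "open V" "V \<subseteq> U"
    using assms(1) Ms unfolding V_def
    by (auto intro!: continuous_open_preimage smooth_on_imp_continuous_on smooth_on_vec_nth)
  have p0V: "p0 \<in> V"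
    using p0 m0[OF p0] by (simp add: V_def M_def R(2))
  have M3: "M q $ 3 > 0" if "q \<in> V" for q using that by (simp add: V_def)
  note sub = smooth_on_subset[OF _ V(2)]
  have Mi: "smooth_on V (\<lambda>q. M q $ i)" and yi: "smooth_on V (\<lambda>q. y q $ i)"
    and Wij: "smooth_on V (\<lambda>q. W q $ k $ l)" for i k l
    by (intro smooth_on_vec_nth V sub Ms ys Ws)+

  define a where "a q = y q $ 1" for q
  define b where "b q = y q $ 2" for q
  define g1 where "g1 q = - (M q $ 1 / M q $ 3)" for q
  define g2 where "g2 q = - (M q $ 2 / M q $ 3)" for q
  have as: "smooth_on V a" and bs: "smooth_on V b"
    unfolding a_def[abs_def] b_def[abs_def] by (rule yi)+
  have g1s: "smooth_on V g1" and g2s: "smooth_on V g2"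
    unfolding g1_def[abs_def] g2_def[abs_def]
    by (intro smooth_on_minus smooth_on_divide V Mi; use M3 in fastforce)+
  note diff = smooth_on_imp_differentiable
  have Dy: "Der y q z = R *v Der x q z" if "q \<in> U" for q z
    unfolding y_def[abs_def] by (rule Der_matrix_mult[OF diff[OF xs that]])
  have Da: "Der a q z = Der y q z $ 1" and Db: "Der b q z = Der y q z $ 2" if "q \<in> V" for q z
    using that V(2) unfolding a_def[abs_def] b_def[abs_def]
    by (auto intro!: Der_vec_nth diff[OF ys])
  have orth: "m q \<bullet> Der x q z = 0" if "q \<in> U" for q z
    using tangent_moving_basis_cross3_orthogonal[OF tmb that diff[OF xs that]] by (simp add: m_def)
  have Dy3: "Der y q z $ 3 = g1 q * Der a q z + g2 q * Der b q z" if "q \<in> V" for q z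
  proof -
    have "q \<in> U" using that V by auto
    then have "M q \<bullet> Der y q z = 0"
      using orth[OF \<open>q \<in> U\<close>] by (simp add: M_def Dy rotation_inner[OF R(1)])
    then show ?thesis using M3[OF that]
      by (simp add: inner_vec_def sum_3 g1_def g2_def Da[OF that] Db[OF that] field_simps)
  qed
  define G where "G = graph_basis g1 g2"
  have Gmult: "G q *v w = vector [w $ 1, w $ 2, g1 q * w $ 1 + g2 q * w $ 2]" for q w
    unfolding G_def by (rule graph_basis_mult)
  have G0: "w = 0" if "G q *v w = 0" for q w
    using that by (simp add: Gmult vec_eq_iff forall_2 forall_3)
  have J: "Jac (pair_map a b) q *v z = vector [Der a q z, Der b q z]"
    and Jg: "Jac (pair_map g1 g2) q *v z = vector [Der g1 q z, Der g2 q z]" if "q \<in> V" for q z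
    by (intro Jac_pair_map diff[OF _ that] as bs g1s g2s)+
  have GJ: "G q *v (Jac (pair_map a b) q *v z) = Der y q z" if "q \<in> V" for q z
    unfolding Gmult J[OF that] using that
    by (simp add: vec_eq_iff forall_3 Dy3 Da Db)
  have WC: "W q ** top_inverse (W q) = G q" if "q \<in> V" for q
    unfolding G_def using M3[OF that]
    by (intro mult_top_inverse) (simp_all add: M_cross g1_def g2_def)
  have Tx: "(\<lambda>v. R *v v) \<circ> x = y" by (simp add: y_def fun_eq_iff)
  have rm: "rigid_motion (\<lambda>v. R *v v)"
    unfolding rigid_motion_def using R(1) by (intro exI[of _ R] exI[of _ 0]) simp

  have Rinj: "u = v" if "R *v u = R *v v" for u v
    using rotation_inner[OF R(1), of "u - v" "u - v"] that by (simp add: matrix_vector_mult_diff_distrib)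
  have tmbG: "tangent_moving_basis V y G"
    unfolding tangent_moving_basis_def Let_def
  proof (intro conjI ballI)
    have "\<forall>i j. smooth_on V (\<lambda>q. G q $ i $ j)"
      by (simp add: forall_2 forall_3 G_def graph_basis_def smooth_on_const V g1s g2s)
    then show "smooth_on V G" by (intro smooth_on_vec V) blast
  next
    fix q assume q: "q \<in> V"
    let ?w1 = "column 1 (G q)" and ?w2 = "column 2 (G q)"
    have w: "?w1 $ 1 = 1" "?w1 $ 2 = 0" "?w2 $ 1 = 0" "?w2 $ 2 = 1"
      by (simp_all add: G_def graph_basis_def column_def)
    then show ne: "?w1 \<noteq> ?w2" by force
    have "?w2 \<noteq> 0" using w by force
    moreover have "?w1 \<notin> span {?w2}"
      using w by (auto simp: span_singleton)
    ultimately show "independent {?w1, ?w2}"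
      by (simp add: independent_insert ne)
    have "G q *v w \<in> span {?w1, ?w2}" for w
      by (simp add: matrix_mult_2_columns span_add span_scale span_base)
    then have "Jac y q *v z \<in> span {?w1, ?w2}" for z
      using GJ[OF q, of z] Jac_mult_vec[OF diff[OF ys], of q z] q V(2) by (metis subsetD)
    then show "column 1 (Jac y q) \<in> span {?w1, ?w2}" "column 2 (Jac y q) \<in> span {?w1, ?w2}"
      by (simp_all add: matrix_vector_mult_basis[symmetric])
  qed
  have LG: "transpose (Lambda y G q) = Jac (pair_map a b) q" if "q \<in> V" for q
  proof -
    have "Jac y q = G q ** Jac (pair_map a b) q"
      unfolding matrix_eq
      using GJ[OF that] Jac_mult_vec[OF diff[OF ys]] that V
      by (auto simp: matrix_vector_mul_assoc[symmetric])
    from Lambda_eq[of G q, OF G0 this] show ?thesis by simp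
  qed

  \<comment> \<open>The original basis also factors \<open>Dx\<close>, since \<open>R\<close> is injective: \<open>R Dx = Dy = G D(a,b) = R \<Omega> C D(a,b)\<close>,
    with \<open>C = top_inverse W\<close>.\<close>
  define L where "L q = top_inverse (W q) ** Jac (pair_map a b) q" for q
  have \<Omega>0: "z = 0" if "\<Omega> q *v z = 0" "q \<in> U" for q z
    using cross3_nonzero_imp_kernel_trivial[OF _ that(1)] m0[OF that(2)] by (simp add: m_def)
  have \<Omega>L: "Jac x q = \<Omega> q ** L q" if q: "q \<in> V" for q
    unfolding matrix_eq
  proof
    fix z
    have qU: "q \<in> U" using q V by auto
    have "R *v (Jac x q *v z) = Der y q z"
      by (simp add: Jac_mult_vec[OF diff[OF xs qU]] Dy[OF qU])
    also have "\<dots> = R *v ((\<Omega> q ** L q) *v z)"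
      unfolding GJ[OF q, symmetric] WC[OF q, symmetric] W_def L_def
      by (simp add: matrix_vector_mul_assoc matrix_mul_assoc)
    finally show "Jac x q *v z = (\<Omega> q ** L q) *v z" by (rule Rinj)
  qed
  have L\<Omega>: "transpose (Lambda x \<Omega> q) = L q" if "q \<in> V" for q
    using Lambda_eq[of \<Omega> q, OF \<Omega>0 \<Omega>L[OF that]] that V by auto

  \<comment> \<open>The quadratic form of the matrix to be found. For \<open>w \<noteq> 0\<close> it is a smooth function of \<open>q\<close>
    on all of \<open>V\<close>, because the second argument of \<open>K\<close> is then nonzero.\<close>
  define Q where "Q w q = norm (M q) / M q $ 3 * K (q, top_inverse (W q) *v w) *
    ((G q *v w) \<bullet> (G q *v w))" for w q
  have C0: "w = 0" if "top_inverse (W q) *v w = 0" "q \<in> V" for q w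
    using that G0[of q w] WC[OF that(2)] by (metis matrix_vector_mul_assoc matrix_vector_mult_0_right)
  have Qs: "smooth_on V (Q w)" if w: "w \<noteq> 0" for w
  proof -
    have "M q $ 1 * M q $ 1 + M q $ 2 * M q $ 2 + M q $ 3 * M q $ 3 > 0" if "q \<in> V" for q
      using M3[OF that] by (intro add_nonneg_pos) auto
    then have n: "smooth_on V (\<lambda>q. norm (M q))"
      unfolding norm_eq_sqrt_inner inner_vec_def sum_3 inner_real_def
      by (intro smooth_on_sqrt smooth_on_add smooth_on_mult V Mi)
    have "\<forall>i. smooth_on V (\<lambda>q. (top_inverse (W q) *v w) $ i)"
      unfolding forall_2 matrix_vector_mult_def top_inverse_def M_cross[symmetric] Let_def
      using M3
      by (auto simp: sum_2 intro!: smooth_on_diff smooth_on_add smooth_on_mult smooth_on_divide smooth_on_minus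
          smooth_on_const V Mi Wij less_imp_neq[symmetric])
    then have "smooth_on V (\<lambda>q. top_inverse (W q) *v w)" by (intro smooth_on_vec V) blast
    then have Kw: "smooth_on V (\<lambda>q. K (q, top_inverse (W q) *v w))"
      using C0 w V(2)
      by (intro smooth_on_compose[OF V(1) Ks] smooth_on_Pair smooth_on_ident V) auto
    have Gw: "smooth_on V (\<lambda>q. (G q *v w) \<bullet> (G q *v w))"
      unfolding Gmult inner_vec_def sum_3 inner_real_def vector_3
      by (intro smooth_on_add smooth_on_mult smooth_on_const V g1s g2s)
    show ?thesis
      unfolding Q_def[abs_def]
      by (intro smooth_on_mult smooth_on_divide V n Kw Gw Mi) (use M3 in force)
  qed
  \<comment> \<open>At regular points \<open>Dx\<close>, and therefore \<open>D(a,b)\<close>, is injective.\<close>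
  have reg0: "v = 0" if "q \<in> V" "q \<notin> singular_set U x" "Der x q v = 0" for q v
  proof -
    have "q \<in> U" using that V by auto
    then have "inj (Der x q)" "linear (Der x q)"
      using that linear_Der[OF diff[OF xs]] by (auto simp: singular_set_def)
    then show ?thesis using that(3) by (simp add: linear_injective_0)
  qed
  have reg: "v = 0" if q: "q \<in> V" "q \<notin> singular_set U x" and v: "Jac (pair_map a b) q *v v = 0" for q v
  proof (rule reg0[OF q])
    have "R *v Der x q v = R *v 0"
      using GJ[OF q(1), of v] Dy[of q v] q V v by auto
    then show "Der x q v = 0" by (rule Rinj)
  qed
  have QJ: "Q (Jac (pair_map a b) q *v z) q = (Jac (pair_map a b) q *v z) \<bullet> (Jac (pair_map g1 g2) q *v z)"
    if q: "q \<in> V" "q \<notin> singular_set U x" and z: "z \<noteq> 0" for q z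
  proof -
    have qU: "q \<in> U" using q V by auto
    have xd: "x differentiable at q" and md: "m differentiable at q" and Md: "M differentiable at q"
      by (intro diff[OF _ qU] xs ms Ms)+
    let ?w = "Jac (pair_map a b) q *v z" and ?\<xi> = "Der x q z"
    have Lz: "L q *v z = top_inverse (W q) *v ?w"
      by (simp add: L_def matrix_vector_mul_assoc)
    have L0: "v = 0" if "L q *v v = 0" for v
    proof (rule reg[OF q])
      show "Jac (pair_map a b) q *v v = 0"
        using that C0[OF _ q(1)] by (simp add: L_def matrix_vector_mul_assoc[symmetric])
    qed
    then have inv: "invertible (L q)" by (rule invertible_ker)
    have \<xi>: "?\<xi> \<bullet> ?\<xi> \<noteq> 0" using reg0[OF q] z by auto
    have n: "normal_field \<Omega> = (\<lambda>q. m q /\<^sub>R norm (m q))"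
      by (simp add: fun_eq_iff normal_field_def m_def Let_def)
    have orth': "m q \<bullet> ?\<xi> = 0" by (rule orth[OF qU])
    note dn = Der_inner_normalized[OF md m0[OF qU] orth', folded n]
    \<comment> \<open>The inverse of \<open>\<Lambda>\<^sup>T\<close> in the argument of the normal curvature is cancelled by evaluating \<open>K\<close> at
      \<open>\<Lambda>\<^sup>T z\<close>.\<close>
    have "K (q, L q *v z) = normal_curvature x \<Omega> q (matrix_inv (L q) *v (L q *v z))"
      using K[of q "L q *v z"] L0[of z] z q qU L\<Omega>[OF q(1)] by auto
    also have "matrix_inv (L q) *v (L q *v z) = z"
      by (simp add: matrix_vector_mul_assoc matrix_inv_mult[OF inv])
    also have "normal_curvature x \<Omega> q z = - (?\<xi> \<bullet> Der m q z / norm (m q)) / (?\<xi> \<bullet> ?\<xi>)"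
      unfolding normal_curvature_eq[OF xd dn(1)] dn(2) ..
    also have "?\<xi> \<bullet> Der m q z = Der y q z \<bullet> Der M q z"
      unfolding M_def[abs_def] Der_matrix_mult[OF md] Dy[OF qU] rotation_inner[OF R(1)] ..
    also have "\<dots> = - (M q $ 3 * (Der y q z $ 1 * Der g1 q z + Der y q z $ 2 * Der g2 q z))"
    proof (rule graph_second_form[OF V(1) q(1) diff[OF g1s q(1)] diff[OF g2s q(1)] Md])
      show "M r $ 1 = - (g1 r * M r $ 3)" "M r $ 2 = - (g2 r * M r $ 3)" if "r \<in> V" for r
        using M3[OF that] by (simp_all add: g1_def g2_def)
      show "Der y q z $ 3 = g1 q * Der y q z $ 1 + g2 q * Der y q z $ 2"
        using Dy3[OF q(1)] Da[OF q(1)] Db[OF q(1)] by simp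
    qed
    also have "Der y q z $ 1 * Der g1 q z + Der y q z $ 2 * Der g2 q z = ?w \<bullet> (Jac (pair_map g1 g2) q *v z)"
      by (simp add: J[OF q(1)] Jg[OF q(1)] Da[OF q(1)] Db[OF q(1)] inner_vec_def sum_2)
    finally have Kq: "K (q, top_inverse (W q) *v ?w) =
        M q $ 3 * (?w \<bullet> (Jac (pair_map g1 g2) q *v z)) / norm (m q) / (?\<xi> \<bullet> ?\<xi>)"
      by (simp add: Lz)
    have Gw: "(G q *v ?w) \<bullet> (G q *v ?w) = ?\<xi> \<bullet> ?\<xi>"
      by (simp only: GJ[OF q(1)] Dy[OF qU] rotation_inner[OF R(1)])
    have nM: "norm (M q) = norm (m q)"
      by (simp add: norm_eq_sqrt_inner M_def rotation_inner[OF R(1)])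
    show ?thesis
      unfolding Q_def Kq Gw nM using M3[OF q(1)] m0[OF qU] \<xi> by simp
  qed

  define h1 where "h1 = Q (axis 1 1)"
  define h3 where "h3 = Q (axis 2 1)"
  define h2 where "h2 q = (Q (axis 1 1 + axis 2 1) q - Q (axis 1 1) q - Q (axis 2 1) q) / 2" for q
  have ax: "axis 1 1 \<noteq> (0::real^2)" "axis 2 1 \<noteq> (0::real^2)" "axis 1 1 + axis 2 1 \<noteq> (0::real^2)"
    by (simp_all add: vec_eq_iff forall_2 axis_def)
  have hs: "smooth_on V h1" "smooth_on V h2" "smooth_on V h3"
    unfolding h1_def h2_def[abs_def] h3_def
    by (intro smooth_on_divide smooth_on_diff smooth_on_const V Qs ax; simp)+
  have H: "Jac (pair_map g1 g2) q = vector [vector [h1 q, h2 q], vector [h2 q, h3 q]] ** Jac (pair_map a b) q"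
    if q: "q \<in> V" for q
  proof -
    \<comment> \<open>The defect of the claimed identity vanishes at regular points and is continuous.\<close>
    define F where "F z q = Jac (pair_map g1 g2) q *v z -
      vector [vector [h1 q, h2 q], vector [h2 q, h3 q]] *v (Jac (pair_map a b) q *v z)" for z q
    have Fi: "F z q $ 1 = Der g1 q z - (h1 q * Der a q z + h2 q * Der b q z)"
      "F z q $ 2 = Der g2 q z - (h2 q * Der a q z + h3 q * Der b q z)" if "q \<in> V" for z q
      unfolding F_def J[OF that] Jg[OF that] by (simp_all add: matrix_vector_mult_def sum_2)
    have zero: "F z q = 0" if q: "q \<in> V - singular_set U x" for q z
    proof -
      have qV: "q \<in> V" "q \<notin> singular_set U x" using q by auto
      have "Jac (pair_map g1 g2) q *v z =
        vector [vector [h1 q, h2 q], vector [h2 q, h3 q]] *v (Jac (pair_map a b) q *v z)"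
      proof (rule symmetric_matrix_from_quadratic_form[where A = "(*v) (Jac (pair_map a b) q)"
            and B = "(*v) (Jac (pair_map g1 g2) q)" and Q = "\<lambda>w. Q w q"])
        show "inj ((*v) (Jac (pair_map a b) q))"
          using reg[OF qV] by (simp add: linear_injective_0)
        show "(Jac (pair_map a b) q *v z) \<bullet> (Jac (pair_map g1 g2) q *v w) =
          (Jac (pair_map a b) q *v w) \<bullet> (Jac (pair_map g1 g2) q *v z)" for z w
        proof -
          have "Der (\<lambda>r. y r $ 3) r z = g1 r * Der a r z + g2 r * Der b r z" if "r \<in> V" for r z
            using Dy3[OF that] Der_vec_nth[OF diff[OF ys]] that V by auto
          from contact_form_symmetric[OF V(1) qV(1) as bs yi g1s g2s this, of z w]
          show ?thesis by (simp add: J[OF qV(1)] Jg[OF qV(1)] inner_vec_def sum_2)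
        qed
      qed (use QJ[OF qV] in \<open>simp_all add: h1_def h2_def h3_def\<close>)
      then show ?thesis by (simp add: F_def)
    qed
    have cont: "\<forall>i. continuous_on V (\<lambda>q. F z q $ i)" for z
      by (simp add: forall_2 Fi smooth_on_imp_continuous_on smooth_on_diff smooth_on_add smooth_on_mult
          smooth_on_Der V hs as bs g1s g2s cong: continuous_on_cong)
    have "F z q $ i = 0" for z i
      by (rule continuous_on_eq_zero_off_empty_interior[OF V(1) cont[rule_format] sing _ q])
        (simp add: zero)
    then have "F z q = 0" for z by (simp add: vec_eq_iff)
    then show ?thesis
      unfolding matrix_eq by (simp add: F_def matrix_vector_mul_assoc)
  qed
  show "\<exists>V T. open V \<and> p0 \<in> V \<and> V \<subseteq> U \<and> rigid_motion T \<and>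
    (\<exists>a b g1 g2 h1 h2 h3 :: real^2 \<Rightarrow> real.
       smooth_on V a \<and> smooth_on V b \<and> smooth_on V g1 \<and> smooth_on V g2 \<and>
       smooth_on V h1 \<and> smooth_on V h2 \<and> smooth_on V h3 \<and>
       tangent_moving_basis V (T \<circ> x) (graph_basis g1 g2) \<and>
       (\<forall>q\<in>V. transpose (Lambda (T \<circ> x) (graph_basis g1 g2) q) = Jac (pair_map a b) q \<and>
          Jac (pair_map g1 g2) q =
            vector [vector [h1 q, h2 q], vector [h2 q, h3 q]] ** Jac (pair_map a b) q))"
  proof (intro exI conjI ballI)
    show "open V" "p0 \<in> V" "V \<subseteq> U" by (rule V p0V)+
    show "rigid_motion (\<lambda>v. R *v v)" by (rule rm)
    show "smooth_on V a" "smooth_on V b" "smooth_on V g1" "smooth_on V g2"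
      by (rule as bs g1s g2s)+
    show "smooth_on V h1" "smooth_on V h2" "smooth_on V h3" by (rule hs)+
    show "tangent_moving_basis V ((\<lambda>v. R *v v) \<circ> x) (graph_basis g1 g2)"
      using tmbG unfolding Tx G_def .
    fix q assume q: "q \<in> V"
    show "transpose (Lambda ((\<lambda>v. R *v v) \<circ> x) (graph_basis g1 g2) q) = Jac (pair_map a b) q"
      using LG[OF q] unfolding Tx G_def .
    show "Jac (pair_map g1 g2) q =
        vector [vector [h1 q, h2 q], vector [h2 q, h3 q]] ** Jac (pair_map a b) q"
      by (rule H[OF q])
  qed
qed

end
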